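(* Let $X\neq\emptyset$ be a set and let $\mathcal E\colon \mathcal F(X)\to[0,\infty]$ be convex with $\mathcal E(0)=0$. Assume that $\mathcal E$ is lower semicontinuous. The following assertions are equivalent: (i) All normal contractions operate on $\mathcal E$. (ii) For every $\alpha>0$ the normal contraction $C_\alpha\colon\mathbb R\to\mathbb R$, $C_\alpha(s)=s\wedge\alpha$, operates on $\mathcal E$. (iii) For every $\beta\in\mathbb R$ the normal contraction $D_\beta\colon\mathbb R\to\mathbb R$, $D_\beta(s)=|s-\beta|-|\beta|$, operates on $\mathcal E$. If for some $1\le p<\infty$ the functional $\mathcal E$ is positively $p$-homogeneous, then these are equivalent to each of the following: (iv) $C_1\colon\mathbb R\to\mathbb R$, $C_1(s)=s\wedge1$, operates on $\mathcal E$. (v) $D_1\colon\mathbb R\to\mathbb R$, $D_1(s)=|s-1|-1$, operates on $\mathcal E$.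
   Context: $\mathcal F(X)$ is the real vector space of all functions $f\colon X\to\mathbb R$, equipped with the topology of pointwise convergence. $\mathcal E$ is lower semicontinuous if $\mathcal E(f)\le\liminf_i\mathcal E(f_i)$ for every net $(f_i)$ converging pointwise to $f$. $\mathcal E$ is positively $p$-homogeneous if $\mathcal E(\lambda f)=\lambda^p\mathcal E(f)$ for all $f\in\mathcal F(X)$ and $\lambda\ge0$ (with $0\cdot\infty=0$). A normal contraction is a $1$-Lipschitz function $C\colon\mathbb R\to\mathbb R$ with $C(0)=0$; for $g\in\mathcal F(X)$ write $Cg=C\circ g$. The normal contraction $C$ operates on $\mathcal E$ if $$\mathcal E(f+Cg)+\mathcal E(f-Cg)\le\mathcal E(f+g)+\mathcal E(f-g)\quad\text{for all }f,g\in\mathcal F(X).$$ $a\wedge b=\min\{a,b\}$. *)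

theory Defs
  imports "HOL-Analysis.Analysis"
begin

text \<open>
  The nonempty set \<open>X\<close> is a type \<open>'x\<close>, so that the space \<open>\<F>(X)\<close> is \<open>'x \<Rightarrow> real\<close>; functionals take
  values in \<open>ennreal = [0,\<infinity>]\<close>, where \<open>0 * \<infinity> = 0\<close>.
\<close>

definition convex_functional :: "(('x \<Rightarrow> real) \<Rightarrow> ennreal) \<Rightarrow> bool" where
  "convex_functional \<E> \<longleftrightarrow>
     (\<forall>f g. \<forall>t\<in>{0..1}.
        \<E> (\<lambda>x. (1 - t) * f x + t * g x) \<le> ennreal (1 - t) * \<E> f + ennreal t * \<E> g)"

text \<open>
  Nets are rendered by filters: up to its eventuality filter, a net in \<open>\<F>(X)\<close> is a filter \<open>F\<close> on
  \<open>\<F>(X)\<close>. The premise says that \<open>F\<close> converges pointwise to \<open>f\<close>. The lemmas below show that this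
  covers families with any index type and agrees with \<open>\<E> f \<le> liminf \<E> g\<close> as \<open>g \<rightarrow> f\<close> in the
  product topology.
\<close>

definition lower_semicontinuous :: "(('x \<Rightarrow> real) \<Rightarrow> ennreal) \<Rightarrow> bool" where
  "lower_semicontinuous \<E> \<longleftrightarrow>
     (\<forall>f F. (\<forall>x. ((\<lambda>h. h x) \<longlongrightarrow> f x) F) \<longrightarrow> \<E> f \<le> Liminf F \<E>)"

lemma lower_semicontinuousD:
  fixes \<E> :: "('x \<Rightarrow> real) \<Rightarrow> ennreal" and u :: "'i \<Rightarrow> 'x \<Rightarrow> real" and G :: "'i filter"
  assumes "lower_semicontinuous \<E>" and "\<And>x. ((\<lambda>i. u i x) \<longlongrightarrow> f x) G"
  shows "\<E> f \<le> Liminf G (\<lambda>i. \<E> (u i))"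
proof -
  have "\<forall>x. ((\<lambda>h. h x) \<longlongrightarrow> f x) (filtermap u G)"
    using assms(2) by (simp add: filterlim_filtermap)
  then have "\<E> f \<le> Liminf (filtermap u G) \<E>"
    using assms(1) unfolding lower_semicontinuous_def by blast
  then show ?thesis
    using Liminf_filtermap_le order_trans by blast
qed

lemma pointwise_tendsto_iff_le_nhds:
  fixes f :: "'x \<Rightarrow> real"
  shows "(\<forall>x. ((\<lambda>h. h x) \<longlongrightarrow> f x) F) \<longleftrightarrow> F \<le> nhds f"
proof -
  have "F \<le> nhds f \<longleftrightarrow> limitin euclidean (\<lambda>h. h) f F"
    by (simp add: filterlim_def)
  also have "\<dots> \<longleftrightarrow> (\<forall>x. ((\<lambda>h. h x) \<longlongrightarrow> f x) F)"
    by (simp add: limitin_componentwise flip: euclidean_product_topology)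
  finally show ?thesis by simp
qed

lemma lower_semicontinuous_iff_nhds:
  fixes \<E> :: "('x \<Rightarrow> real) \<Rightarrow> ennreal"
  shows "lower_semicontinuous \<E> \<longleftrightarrow> (\<forall>f. \<E> f \<le> Liminf (nhds f) \<E>)"
proof -
  have "Liminf (nhds f) \<E> \<le> Liminf F \<E>" if "F \<le> nhds f" for f F
    unfolding Liminf_def using that by (intro SUP_subset_mono) (auto simp: filter_leD)
  then show ?thesis
    unfolding lower_semicontinuous_def pointwise_tendsto_iff_le_nhds
    by (meson order_refl order_trans)
qed

definition positively_homogeneous :: "real \<Rightarrow> (('x \<Rightarrow> real) \<Rightarrow> ennreal) \<Rightarrow> bool" where
  "positively_homogeneous p \<E> \<longleftrightarrow>
     (\<forall>f. \<forall>l\<ge>0. \<E> (\<lambda>x. l * f x) = ennreal (l powr p) * \<E> f)"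

definition normal_contraction :: "(real \<Rightarrow> real) \<Rightarrow> bool" where
  "normal_contraction C \<longleftrightarrow> 1-lipschitz_on UNIV C \<and> C 0 = 0"

definition operates_on :: "(real \<Rightarrow> real) \<Rightarrow> (('x \<Rightarrow> real) \<Rightarrow> ennreal) \<Rightarrow> bool" where
  "operates_on C \<E> \<longleftrightarrow>
     (\<forall>f g. \<E> (\<lambda>x. f x + C (g x)) + \<E> (\<lambda>x. f x - C (g x))
          \<le> \<E> (\<lambda>x. f x + g x) + \<E> (\<lambda>x. f x - g x))"

definition C_cut :: "real \<Rightarrow> real \<Rightarrow> real" where
  "C_cut \<alpha> s = min s \<alpha>"

definition D_fold :: "real \<Rightarrow> real \<Rightarrow> real" where
  "D_fold \<beta> s = \<bar>s - \<beta>\<bar> - \<bar>\<beta>\<bar>"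

lemma normal_contraction_C_cut: "\<alpha> > 0 \<Longrightarrow> normal_contraction (C_cut \<alpha>)"
  by (auto simp: normal_contraction_def C_cut_def lipschitz_on_def dist_real_def)

lemma normal_contraction_D_fold: "normal_contraction (D_fold \<beta>)"
  by (auto simp: normal_contraction_def D_fold_def lipschitz_on_def dist_real_def)

end

theory Submission
  imports Defs
begin

text \<open>
  The heart of the matter is (ii) \<open>\<Longrightarrow>\<close> (i). If \<open>u \<le> \<alpha>\<close>, \<open>w \<ge> 0\<close> and \<open>u = \<alpha>\<close> wherever \<open>w > 0\<close>, then
  \<open>C\<^sub>\<alpha>\<close> maps \<open>u + b w\<close> to \<open>u\<close> for every \<open>b \<ge> 0\<close>. Applying (ii) with small \<open>b\<close> along a fine grid in
  direction \<open>w\<close> and telescoping yields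
  \<open>\<E>(f + (u - w)) + \<E>(f - (u - w)) \<le> \<E>(f + (u + w)) + \<E>(f - (u + w))\<close>, a supermodularity of \<open>\<E>\<close> in the
  directions \<open>u\<close> and \<open>w\<close>. For smooth \<open>\<E>\<close> this is the sign of a mixed second derivative; here lower
  semicontinuity replaces differentiability.

  Cut \<open>g\<close> into slices between consecutive levels. Adding slices from \<open>0\<close> outwards, each new slice
  is nonzero only where all previous ones are extremal, so the inequality above permits changing its
  sign, and by convexity multiplying it by any factor in \<open>[-1, 1]\<close>. This gives all piecewise linear
  normal contractions, and lower semicontinuity gives the rest. Finally, (iii) implies (ii) by
  convexity because \<open>C\<^sub>\<alpha>\<close> is the mean of \<open>id\<close> and \<open>- D\<^sub>\<alpha>\<close>.
\<close>

section \<open>Domination between pairs of functions\<close>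

text \<open>A contraction \<open>C\<close> operates exactly when every \<open>g\<close> dominates
  \<open>C o g\<close>. Separating the pair from \<open>C\<close> gives a preorder in which
  functions can be compared slice by slice. Since \<open>f\<close> ranges over all functions, it may
  be shifted freely in every application.\<close>

definition dominated :: "(('x \<Rightarrow> real) \<Rightarrow> ennreal) \<Rightarrow> ('x \<Rightarrow> real) \<Rightarrow> ('x \<Rightarrow> real) \<Rightarrow> bool" where
  "dominated \<E> g k \<longleftrightarrow>
     (\<forall>f. \<E> (\<lambda>x. f x + k x) + \<E> (\<lambda>x. f x - k x) \<le> \<E> (\<lambda>x. f x + g x) + \<E> (\<lambda>x. f x - g x))"

lemma dominatedD:
  assumes "dominated \<E> g k" and "p1 = (\<lambda>x. f x + k x)" "p2 = (\<lambda>x. f x - k x)"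
    "q1 = (\<lambda>x. f x + g x)" "q2 = (\<lambda>x. f x - g x)"
  shows "\<E> p1 + \<E> p2 \<le> \<E> q1 + \<E> q2"
  using assms unfolding dominated_def by blast

lemma operates_on_iff_dominated: "operates_on C \<E> \<longleftrightarrow> (\<forall>g. dominated \<E> g (\<lambda>x. C (g x)))"
  unfolding operates_on_def dominated_def by blast

lemma dominated_refl: "dominated \<E> g g"
  by (simp add: dominated_def)

lemma dominated_trans: "dominated \<E> g k \<Longrightarrow> dominated \<E> k l \<Longrightarrow> dominated \<E> g l"
  unfolding dominated_def by (meson order_trans)

lemma dominated_uminus_right [simp]: "dominated \<E> g (\<lambda>x. - k x) \<longleftrightarrow> dominated \<E> g k"
  by (simp add: dominated_def add.commute)

lemma dominated_uminus_left [simp]: "dominated \<E> (\<lambda>x. - g x) k \<longleftrightarrow> dominated \<E> g k"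
  by (simp add: dominated_def add.commute)

text \<open>Convexity of \<open>\<E>\<close> is applied to the terms \<open>f + _\<close> and
  \<open>f - _\<close> separately, and the two estimates are added. Together with invariance under
  sign change this later admits all slopes between -1 and 1.\<close>

lemma dominated_convex:
  assumes "convex_functional \<E>" and k: "dominated \<E> g k" and l: "dominated \<E> g l"
    and t: "0 \<le> t" "t \<le> 1"
  shows "dominated \<E> g (\<lambda>x. (1 - t) * k x + t * l x)"
  unfolding dominated_def
proof
  fix f :: "'a \<Rightarrow> real"
  let ?M = "\<E> (\<lambda>x. f x + g x) + \<E> (\<lambda>x. f x - g x)"
  have conv: "\<E> (\<lambda>x. (1 - t) * u x + t * v x) \<le> ennreal (1 - t) * \<E> u + ennreal t * \<E> v" for u v
    using assms(1) t unfolding convex_functional_def by simp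
  have 1: "\<E> (\<lambda>x. f x + ((1 - t) * k x + t * l x)) \<le>
      ennreal (1 - t) * \<E> (\<lambda>x. f x + k x) + ennreal t * \<E> (\<lambda>x. f x + l x)"
    using conv[of "\<lambda>x. f x + k x" "\<lambda>x. f x + l x"] by (simp add: algebra_simps)
  have 2: "\<E> (\<lambda>x. f x - ((1 - t) * k x + t * l x)) \<le>
      ennreal (1 - t) * \<E> (\<lambda>x. f x - k x) + ennreal t * \<E> (\<lambda>x. f x - l x)"
    using conv[of "\<lambda>x. f x - k x" "\<lambda>x. f x - l x"] by (simp add: algebra_simps)
  have "\<E> (\<lambda>x. f x + ((1 - t) * k x + t * l x)) + \<E> (\<lambda>x. f x - ((1 - t) * k x + t * l x))
      \<le> ennreal (1 - t) * (\<E> (\<lambda>x. f x + k x) + \<E> (\<lambda>x. f x - k x)) +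
        ennreal t * (\<E> (\<lambda>x. f x + l x) + \<E> (\<lambda>x. f x - l x))"
    using add_mono[OF 1 2] by (simp add: distrib_left ac_simps)
  also have "\<dots> \<le> ennreal (1 - t) * ?M + ennreal t * ?M"
    using k l unfolding dominated_def by (intro add_mono[OF mult_left_mono mult_left_mono]) auto
  also have "\<dots> = ?M"
    using t by (simp flip: distrib_right ennreal_plus)
  finally show "\<E> (\<lambda>x. f x + ((1 - t) * k x + t * l x)) + \<E> (\<lambda>x. f x - ((1 - t) * k x + t * l x)) \<le> ?M" .
qed

section \<open>Limits under lower semicontinuity\<close>

lemma lower_semicontinuous_add_le:
  assumes lsc: "lower_semicontinuous \<E>"
    and u: "\<And>x. (\<lambda>n::nat. u n x) \<longlonglongrightarrow> u' x" and v: "\<And>x. (\<lambda>n. v n x) \<longlonglongrightarrow> v' x"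
    and le: "eventually (\<lambda>n. \<E> (u n) + \<E> (v n) \<le> M) sequentially"
  shows "\<E> u' + \<E> v' \<le> M"
proof (rule ccontr)
  assume "\<not> \<E> u' + \<E> v' \<le> M"
  then have M: "M < \<E> u' + \<E> v'" by simp
  have lu: "\<E> u' \<le> liminf (\<lambda>n. \<E> (u n))" and lv: "\<E> v' \<le> liminf (\<lambda>n. \<E> (v n))"
    using lower_semicontinuousD[OF lsc] u v by blast+
  have "liminf (\<lambda>n. \<E> (u n)) + liminf (\<lambda>n. \<E> (v n)) \<le> liminf (\<lambda>n. \<E> (u n) + \<E> (v n))"
  proof -
    \<comment> \<open>Tail infima increase, so the sum of their suprema is the supremum of their
      sums. This makes liminf superadditive.\<close>
    have inc: "incseq (\<lambda>n. INF m\<in>{n..}. \<E> (h m))" for h :: "nat \<Rightarrow> 'a \<Rightarrow> real"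
      by (intro monoI INF_superset_mono) auto
    show ?thesis
      unfolding liminf_SUP_INF ennreal_SUP_add[OF inc inc, symmetric]
      by (intro SUP_mono) (auto intro!: INF_greatest add_mono INF_lower)
  qed
  also have "\<dots> \<le> M"
    using Liminf_mono[OF le] by (simp add: Liminf_const)
  finally show False
    using M add_mono[OF lu lv] by simp
qed

lemma dominated_lim:
  assumes "lower_semicontinuous \<E>" and "\<And>x. (\<lambda>n::nat. k n x) \<longlonglongrightarrow> l x"
    and "\<And>n. dominated \<E> g (k n)"
  shows "dominated \<E> g l"
  unfolding dominated_def
proof
  fix f :: "'a \<Rightarrow> real"
  show "\<E> (\<lambda>x. f x + l x) + \<E> (\<lambda>x. f x - l x) \<le> \<E> (\<lambda>x. f x + g x) + \<E> (\<lambda>x. f x - g x)"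
    using assms unfolding dominated_def
    by (intro lower_semicontinuous_add_le[where u = "\<lambda>n x. f x + k n x" and v = "\<lambda>n x. f x - k n x"])
      (auto intro!: tendsto_intros)
qed

section \<open>Telescoping on dyadic grids\<close>

text \<open>
  The telescoping below cancels values of \<open>a\<close> and \<open>b\<close>, which is legitimate only once these are known
  to be finite; halving the step propagates finiteness from the two end points.
\<close>

lemma dyadic_finite:
  fixes a b :: "real \<Rightarrow> ennreal"
  assumes H: "\<And>s y. 0 \<le> y \<Longrightarrow> a s + b s \<le> a (s + y) + b (s - y)"
    and fin: "a 1 < \<infinity>" "b 0 < \<infinity>"
  shows "(1 \<le> i \<and> i \<le> 2 ^ k \<longrightarrow> a (real i / 2 ^ k) < \<infinity>) \<and> (i < 2 ^ k \<longrightarrow> b (real i / 2 ^ k) < \<infinity>)"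
proof (induction k arbitrary: i)
  case 0
  then show ?case using fin by (auto simp: le_Suc_eq)
next
  case (Suc k)
  show ?case
  proof (cases "even i")
    case True
    then obtain j where "i = 2 * j" by blast
    then show ?thesis using Suc[of j] by auto
  next
    case False
    then obtain j where j: "i = 2 * j + 1" by (auto elim: oddE)
    \<comment> \<open>An odd index is the midpoint of two neighbours on the coarser grid.
      \<open>H\<close> with half the coarse step bounds both new values by \<open>a\<close> at the
      right neighbour and \<open>b\<close> at the left one.\<close>
    have eqs: "real i / 2 ^ Suc k + 1 / 2 ^ Suc k = real (Suc j) / 2 ^ k"
      "real i / 2 ^ Suc k - 1 / 2 ^ Suc k = real j / 2 ^ k"
      by (simp_all add: j field_simps)
    have *: "a (real i / 2 ^ Suc k) + b (real i / 2 ^ Suc k) \<le> a (real (Suc j) / 2 ^ k) + b (real j / 2 ^ k)"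
      using H[of "1 / 2 ^ Suc k" "real i / 2 ^ Suc k"] unfolding eqs by simp
    show ?thesis
    proof (cases "j < 2 ^ k")
      case True
      then have "a (real (Suc j) / 2 ^ k) + b (real j / 2 ^ k) < \<infinity>"
        using Suc[of j] Suc[of "Suc j"] by simp
      then have "a (real i / 2 ^ Suc k) + b (real i / 2 ^ Suc k) < \<infinity>"
        using * by (rule le_less_trans[rotated])
      then show ?thesis by simp
    next
      case False
      then show ?thesis using j by auto
    qed
  qed
qed

text \<open>Summing \<open>H\<close> over consecutive grid points cancels all intermediate values.
  As \<open>k\<close> grows, the arguments on the left tend to 0 for \<open>a\<close> and to 1 for
  \<open>b\<close>, so the end points get exchanged.\<close>

lemma dyadic_telescope:
  fixes a b :: "real \<Rightarrow> ennreal"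
  assumes H: "\<And>s y. 0 \<le> y \<Longrightarrow> a s + b s \<le> a (s + y) + b (s - y)"
    and fin: "a 1 < \<infinity>" "b 0 < \<infinity>"
  shows "a (1 / 2 ^ k) + b (1 - 1 / 2 ^ k) \<le> a 1 + b 0"
proof -
  define A where "A i = a (real i / 2 ^ k)" for i :: nat
  define B where "B i = b (real i / 2 ^ k)" for i :: nat
  have finA: "A i < \<infinity>" if "1 \<le> i" "i \<le> 2 ^ k" for i
    using dyadic_finite[of a b i k, OF H fin] that by (simp add: A_def)
  have finB: "B i < \<infinity>" if "i < 2 ^ k" for i
    using dyadic_finite[of a b i k, OF H fin] that by (simp add: B_def)
  have step: "A (Suc i) + B (Suc i) \<le> A (Suc (Suc i)) + B i" for i
    using H[of "1 / 2 ^ k" "real (Suc i) / 2 ^ k"] unfolding A_def B_def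
    by (simp add: add_divide_distrib[symmetric] diff_divide_distrib[symmetric] add.commute)
  have "A 1 + B i \<le> A (Suc i) + B 0" if "i < 2 ^ k" for i
    using that
  proof (induction i)
    case 0
    then show ?case by simp
  next
    case (Suc i)
    have IH: "A 1 + B i \<le> A (Suc i) + B 0" using Suc by simp
    \<comment> \<open>The induction hypothesis and the next grid inequality are added;
      \<open>A (Suc i) + B i\<close> then stands on both sides.\<close>
    have "(A (Suc i) + B i) + (A 1 + B (Suc i)) \<le> (A (Suc i) + B i) + (A (Suc (Suc i)) + B 0)"
      using add_mono[OF IH step[of i]] by (simp add: ac_simps)
    moreover have "A (Suc i) + B i \<noteq> top"
      using finA[of "Suc i"] finB[of i] Suc by (simp add: less_top)
    ultimately show ?case
      by (simp add: ennreal_add_left_cancel_le)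
  qed
  from this[of "2 ^ k - 1"] have "A 1 + B (2 ^ k - 1) \<le> A (2 ^ k) + B 0" by simp
  then show ?thesis
    by (simp add: A_def B_def of_nat_diff diff_divide_distrib)
qed

section \<open>Changing the sign of one summand\<close>

lemma dominated_sum_diff:
  assumes lsc: "lower_semicontinuous \<E>"
    and H: "\<And>b. b \<ge> 0 \<Longrightarrow> dominated \<E> (\<lambda>x. u x + b * w x) u"
  shows "dominated \<E> (\<lambda>x. u x + w x) (\<lambda>x. u x - w x)"
  unfolding dominated_def
proof
  fix f :: "'a \<Rightarrow> real"
  \<comment> \<open>The coefficient \<open>2 * s - 1\<close> runs from -1 to 1, so
    \<open>?a 1\<close> and \<open>?b 0\<close> are the terms of the upper bound, while
    \<open>?a 0\<close> and \<open>?b 1\<close> are the terms to be estimated. The factor 2 explains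
    the choice \<open>2 * y\<close> below.\<close>
  let ?a = "\<lambda>s. \<E> (\<lambda>x. f x + u x + (2 * s - 1) * w x)"
  let ?b = "\<lambda>s. \<E> (\<lambda>x. f x - u x + (2 * s - 1) * w x)"
  have H': "?a s + ?b s \<le> ?a (s + y) + ?b (s - y)" if "0 \<le> y" for s y
    by (rule dominatedD[OF H[of "2 * y"], where f = "\<lambda>x. f x + (2 * s - 1) * w x"])
      (use that in \<open>auto simp: algebra_simps\<close>)
  show "\<E> (\<lambda>x. f x + (u x - w x)) + \<E> (\<lambda>x. f x - (u x - w x))
     \<le> \<E> (\<lambda>x. f x + (u x + w x)) + \<E> (\<lambda>x. f x - (u x + w x))" (is "_ \<le> ?M")
  proof (cases "?M = top")
    case False
    have M: "?M = ?a 1 + ?b 0" by (simp add: algebra_simps)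
    have fin: "?a 1 < \<infinity>" "?b 0 < \<infinity>"
      using False unfolding M by (simp_all add: less_top)
    have le: "?a (1 / 2 ^ k) + ?b (1 - 1 / 2 ^ k) \<le> ?M" for k
      unfolding M by (rule dyadic_telescope[OF H' fin])
    have 0: "(\<lambda>k. 1 / 2 ^ k :: real) \<longlonglongrightarrow> 0"
      using LIMSEQ_power_zero[of "1/2 :: real"] by (simp add: power_divide)
    have 1: "(\<lambda>k. f x + u x + (2 * (1 / 2 ^ k) - 1) * w x) \<longlonglongrightarrow> f x + u x + (2 * 0 - 1) * w x" for x
      by (intro tendsto_intros 0)
    have 2: "(\<lambda>k. f x - u x + (2 * (1 - 1 / 2 ^ k) - 1) * w x) \<longlonglongrightarrow> f x - u x + (2 * (1 - 0) - 1) * w x" for x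
      by (intro tendsto_intros 0)
    \<comment> \<open>The grid stops one step short of \<open>?a 0\<close> and \<open>?b 1\<close>,
      whose finiteness is not yet known; lower semicontinuity closes this gap.\<close>
    have "\<E> (\<lambda>x. f x + u x + (2 * 0 - 1) * w x) + \<E> (\<lambda>x. f x - u x + (2 * (1 - 0) - 1) * w x) \<le> ?M"
      by (rule lower_semicontinuous_add_le[OF lsc 1 2]) (use le in simp)
    then show ?thesis by (simp add: algebra_simps)
  qed (simp only: top_greatest)
qed

lemma dominated_cut:
  assumes lsc: "lower_semicontinuous \<E>" and C: "operates_on (C_cut \<alpha>) \<E>"
    and "\<And>x. u x \<le> \<alpha>" "\<And>x. 0 \<le> w x" "\<And>x. w x > 0 \<Longrightarrow> u x = \<alpha>"
  shows "dominated \<E> (\<lambda>x. u x + w x) (\<lambda>x. u x - w x)"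
proof (rule dominated_sum_diff[OF lsc])
  fix b :: real assume "b \<ge> 0"
  have "C_cut \<alpha> (u x + b * w x) = u x" for x
  proof (cases "w x > 0")
    case True
    then show ?thesis using assms \<open>b \<ge> 0\<close> by (simp add: C_cut_def)
  next
    case False
    then have "w x = 0" using assms(4)[of x] by simp
    then show ?thesis using assms(3)[of x] by (simp add: C_cut_def)
  qed
  then show "dominated \<E> (\<lambda>x. u x + b * w x) u"
    using C[unfolded operates_on_iff_dominated, rule_format, of "\<lambda>x. u x + b * w x"] by simp
qed

text \<open>In the inequality for \<open>u\<close>, \<open>v\<close> shifted by \<open>-w\<close>
  and the one for \<open>u\<close>, \<open>w\<close> shifted by \<open>v\<close>, the values
  \<open>?c\<close> and \<open>?d\<close> occur on opposite sides and cancel in the sum. The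
  inequality \<open>uvw\<close> makes \<open>?c\<close> finite, and then \<open>?d\<close> is finite
  by the first of the two.\<close>

lemma dominated_add:
  assumes uv: "dominated \<E> (\<lambda>x. u x + v x) (\<lambda>x. u x - v x)"
    and uw: "dominated \<E> (\<lambda>x. u x + w x) (\<lambda>x. u x - w x)"
    and uvw: "dominated \<E> (\<lambda>x. (u x + v x) + w x) (\<lambda>x. (u x + v x) - w x)"
  shows "dominated \<E> (\<lambda>x. (u x + v x) + w x) (\<lambda>x. (u x - v x) - w x)"
  unfolding dominated_def
proof
  fix f :: "'a \<Rightarrow> real"
  let ?p = "\<E> (\<lambda>x. f x + ((u x - v x) - w x))" and ?q = "\<E> (\<lambda>x. f x - ((u x - v x) - w x))"
  let ?P = "\<E> (\<lambda>x. f x + ((u x + v x) + w x))" and ?Q = "\<E> (\<lambda>x. f x - ((u x + v x) + w x))"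
  let ?c = "\<E> (\<lambda>x. f x + u x + v x - w x)" and ?d = "\<E> (\<lambda>x. f x - u x + v x - w x)"
  let ?e = "\<E> (\<lambda>x. f x - u x - v x + w x)"
  have 1: "?c + ?e \<le> ?P + ?Q"
    by (rule dominatedD[OF uvw, where f = f]) (auto simp: algebra_simps)
  have 2: "?p + ?d \<le> ?c + ?Q"
    by (rule dominatedD[OF uv, where f = "\<lambda>x. f x - w x"]) (auto simp: algebra_simps)
  have 3: "?c + ?q \<le> ?P + ?d"
    by (rule dominatedD[OF uw, where f = "\<lambda>x. f x + v x"]) (auto simp: algebra_simps)
  show "?p + ?q \<le> ?P + ?Q"
  proof (cases "?P + ?Q = top")
    case False
    then have c: "?c < top" using 1 by (auto simp: less_top[symmetric] top_unique)
    then have d: "?d < top" using 2 False by (auto simp: less_top[symmetric] top_unique)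
    have "(?c + ?d) + (?p + ?q) \<le> (?c + ?d) + (?P + ?Q)"
      using add_mono[OF 2 3] by (simp add: ac_simps)
    then show ?thesis using c d by (auto simp: ennreal_add_left_cancel_le)
  qed (simp only: top_greatest)
qed

section \<open>Composition, reflection and clipping\<close>

lemma operates_on_compose:
  "operates_on C \<E> \<Longrightarrow> operates_on D \<E> \<Longrightarrow> operates_on (\<lambda>s. C (D s)) \<E>"
  unfolding operates_on_iff_dominated using dominated_trans by blast

lemma operates_on_reflect:
  assumes "operates_on C \<E>"
  shows "operates_on (\<lambda>s. - C (- s)) \<E>"
  unfolding operates_on_iff_dominated
proof
  fix g
  show "dominated \<E> g (\<lambda>x. - C (- g x))"
    using assms[unfolded operates_on_iff_dominated, rule_format, of "\<lambda>x. - g x"] by simp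
qed

text \<open>Level 0 does arise: the slicing below starts from a clip with both bounds 0, and its cut
  levels \<open>(b + K b) / 2\<close> and \<open>(b - K b) / 2\<close> may vanish.\<close>

lemma operates_on_C_cut_nonneg:
  assumes lsc: "lower_semicontinuous \<E>" and C: "\<forall>\<alpha>>0. operates_on (C_cut \<alpha>) \<E>" and "0 \<le> \<alpha>"
  shows "operates_on (C_cut \<alpha>) \<E>"
  unfolding operates_on_iff_dominated
proof
  fix g
  show "dominated \<E> g (\<lambda>x. C_cut \<alpha> (g x))"
  proof (rule dominated_lim[OF lsc])
    show "dominated \<E> g (\<lambda>x. C_cut (\<alpha> + 1 / real (Suc n)) (g x))" for n
      using C \<open>0 \<le> \<alpha>\<close> unfolding operates_on_iff_dominated by (simp add: add_nonneg_pos)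
    have "(\<lambda>n. min (g x) (\<alpha> + 1 / real (Suc n))) \<longlonglongrightarrow> min (g x) (\<alpha> + 0)" for x
      by (intro tendsto_intros LIMSEQ_Suc lim_1_over_n)
    then show "(\<lambda>n. C_cut (\<alpha> + 1 / real (Suc n)) (g x)) \<longlonglongrightarrow> C_cut \<alpha> (g x)" for x
      by (simp add: C_cut_def)
  qed
qed

text \<open>The lower bound is given by its size, so that reflection simply swaps \<open>a\<close>
  and \<open>b\<close>.\<close>

definition clip :: "real \<Rightarrow> real \<Rightarrow> real \<Rightarrow> real" where
  "clip a b s = max (- a) (min s b)"

lemma operates_on_clip:
  assumes lsc: "lower_semicontinuous \<E>" and C: "\<forall>\<alpha>>0. operates_on (C_cut \<alpha>) \<E>"
    and "0 \<le> a" "0 \<le> b"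
  shows "operates_on (clip a b) \<E>"
proof -
  have "clip a b = (\<lambda>s. - C_cut a (- C_cut b s))"
    by (auto simp: clip_def C_cut_def)
  then show ?thesis
    using operates_on_compose[OF operates_on_reflect]
      operates_on_C_cut_nonneg[OF lsc C] assms(3,4) by metis
qed

section \<open>Building piecewise linear contractions from slices\<close>

text \<open>
  The induction invariant for adding slices. Since \<open>K\<close> is constant outside \<open>[-a, b]\<close>, it is compared
  with the clipped function and not with \<open>g\<close> itself.
\<close>

definition clip_operates :: "(('x \<Rightarrow> real) \<Rightarrow> ennreal) \<Rightarrow> real \<Rightarrow> real \<Rightarrow> (real \<Rightarrow> real) \<Rightarrow> bool" where
  "clip_operates \<E> a b K \<longleftrightarrow> 0 \<le> a \<and> 0 \<le> b \<and> normal_contraction K \<and> (\<forall>s. K (clip a b s) = K s) \<and>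
     (\<forall>g. dominated \<E> (\<lambda>x. clip a b (g x)) (\<lambda>x. K (g x)))"

lemma normal_contractionD: "normal_contraction C \<Longrightarrow> \<bar>C s - C t\<bar> \<le> \<bar>s - t\<bar>"
  by (auto simp: normal_contraction_def lipschitz_on_def dist_real_def)

lemma normal_contraction_zero: "normal_contraction C \<Longrightarrow> C 0 = 0"
  by (simp add: normal_contraction_def)

lemma normal_contractionI:
  assumes "C 0 = 0" and "\<And>s t. s \<le> t \<Longrightarrow> \<bar>C s - C t\<bar> \<le> t - s"
  shows "normal_contraction C"
proof -
  have "\<bar>C s - C t\<bar> \<le> \<bar>s - t\<bar>" for s t
    using assms(2)[of s t] assms(2)[of t s] by linarith
  then show ?thesis
    using assms(1) by (simp add: normal_contraction_def lipschitz_on_def dist_real_def)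
qed

text \<open>By convexity only the slopes -1 and 1 matter. With the clipped function written as
  \<open>u + v\<close> and \<open>K\<close> as \<open>u - v\<close>, \<open>dominated_add\<close>
  yields \<open>K - W\<close>. Exchanging \<open>u\<close> and \<open>v\<close> yields
  \<open>- K - W\<close>, which is \<open>K + W\<close> up to sign.\<close>

lemma clip_operates_extend:
  assumes lsc: "lower_semicontinuous \<E>" and conv: "convex_functional \<E>"
    and C: "\<forall>\<alpha>>0. operates_on (C_cut \<alpha>) \<E>"
    and K: "clip_operates \<E> a b K" and d: "0 \<le> d" and \<sigma>: "\<bar>\<sigma>\<bar> \<le> 1"
  shows "clip_operates \<E> a (b + d) (\<lambda>s. K s + \<sigma> * max 0 (min (s - b) d))"
proof -
  define W where "W s = max 0 (min (s - b) d)" for s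
  have ab: "0 \<le> a" "0 \<le> b" and nc: "normal_contraction K"
    and Kclip: "\<And>s. K (clip a b s) = K s"
    and dom: "\<And>g. dominated \<E> (\<lambda>x. clip a b (g x)) (\<lambda>x. K (g x))"
    using K by (auto simp: clip_operates_def)
  have clip_eq: "clip a (b + d) s = clip a b s + W s" for s
    using ab d by (auto simp: clip_def W_def)
  have W_clip: "W (clip a (b + d) s) = W s" for s
    using ab d by (auto simp: clip_def W_def)
  have K_clip': "K (clip a (b + d) s) = K s" for s
  proof -
    have "clip a b (clip a (b + d) s) = clip a b s"
      using ab d by (auto simp: clip_def)
    then show ?thesis by (metis Kclip)
  qed
  have W_nonneg: "0 \<le> W s" for s by (simp add: W_def)
  have K_top: "K s = K b" if "W s > 0" for s
  proof -
    have "clip a b s = clip a b b" using that ab by (auto simp: clip_def W_def split: if_splits)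
    then show ?thesis by (metis Kclip)
  qed
  have clip_top: "clip a b s = b" if "W s > 0" for s
    using that ab by (auto simp: clip_def W_def split: if_splits)
  have clip_le: "clip a b s \<le> b" for s
    using ab by (auto simp: clip_def)
  \<comment> \<open>Both signs of this estimate are used: they bound \<open>u\<close> and
    \<open>v\<close> by their values at level \<open>b\<close>.\<close>
  have K_diff: "\<bar>K s - K b\<bar> \<le> b - clip a b s" for s
    using normal_contractionD[OF nc, of "clip a b s" b] clip_le[of s] by (simp add: Kclip)
  have Kb: "\<bar>K b\<bar> \<le> b"
    using normal_contractionD[OF nc, of b 0] normal_contraction_zero[OF nc] ab by simp
  have nc': "normal_contraction (\<lambda>s. K s + \<sigma> * W s)"
  proof (rule normal_contractionI)
    show "K 0 + \<sigma> * W 0 = 0"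
      using normal_contraction_zero[OF nc] ab by (simp add: W_def)
    fix s t :: real assume "s \<le> t"
    \<comment> \<open>\<open>K\<close> moves at most as much as the clipped part and
      \<open>\<sigma> * W\<close> at most as much as the new slice. The two bounds add up to the
      increment of \<open>clip a (b + d)\<close>.\<close>
    have "\<bar>K s - K t\<bar> \<le> \<bar>clip a b s - clip a b t\<bar>"
      using normal_contractionD[OF nc, of "clip a b s" "clip a b t"] by (simp add: Kclip)
    also have "\<dots> = clip a b t - clip a b s"
      using \<open>s \<le> t\<close> by (auto simp: clip_def)
    finally have 1: "\<bar>K s - K t\<bar> \<le> clip a b t - clip a b s" .
    have "\<bar>\<sigma> * (W s - W t)\<bar> \<le> 1 * \<bar>W s - W t\<bar>"
      unfolding abs_mult using \<sigma> by (rule mult_right_mono) simp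
    also have "\<dots> = W t - W s"
      using \<open>s \<le> t\<close> by (auto simp: W_def)
    finally have 2: "\<bar>\<sigma> * (W s - W t)\<bar> \<le> W t - W s" .
    have "(K s + \<sigma> * W s) - (K t + \<sigma> * W t) = (K s - K t) + \<sigma> * (W s - W t)"
      by (simp add: algebra_simps)
    then have "\<bar>(K s + \<sigma> * W s) - (K t + \<sigma> * W t)\<bar> \<le> clip a (b + d) t - clip a (b + d) s"
      using 1 2 unfolding clip_eq by linarith
    also have "\<dots> \<le> t - s"
      using \<open>s \<le> t\<close> by (auto simp: clip_def)
    finally show "\<bar>(K s + \<sigma> * W s) - (K t + \<sigma> * W t)\<bar> \<le> t - s" .
  qed
  have dom': "dominated \<E> (\<lambda>x. clip a (b + d) (g x)) (\<lambda>x. K (g x) + \<sigma> * W (g x))" for g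
  proof -
    \<comment> \<open>\<open>K\<close> being a contraction makes \<open>u\<close> and \<open>v\<close> nondecreasing in \<open>g\<close>, hence maximal where \<open>W > 0\<close>.\<close>
    define u where "u x = (clip a b (g x) + K (g x)) / 2" for x
    define v where "v x = (clip a b (g x) - K (g x)) / 2" for x
    have uv: "u x + v x = clip a b (g x)" "u x - v x = K (g x)" for x
      by (simp_all add: u_def v_def field_simps)
    have cut: "dominated \<E> (\<lambda>x. h x + W (g x)) (\<lambda>x. h x - W (g x))"
      if "0 \<le> \<alpha>" "\<And>x. h x \<le> \<alpha>" "\<And>x. W (g x) > 0 \<Longrightarrow> h x = \<alpha>" for h \<alpha>
      by (rule dominated_cut[OF lsc operates_on_C_cut_nonneg[OF lsc C \<open>0 \<le> \<alpha>\<close>]])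
        (use that W_nonneg in auto)
    have uw: "dominated \<E> (\<lambda>x. u x + W (g x)) (\<lambda>x. u x - W (g x))"
    proof (rule cut[of "(b + K b) / 2"])
      show "u x \<le> (b + K b) / 2" for x using K_diff[of "g x"] by (simp add: u_def)
    qed (use Kb in \<open>auto simp: u_def K_top clip_top\<close>)
    have vw: "dominated \<E> (\<lambda>x. v x + W (g x)) (\<lambda>x. v x - W (g x))"
    proof (rule cut[of "(b - K b) / 2"])
      show "v x \<le> (b - K b) / 2" for x using K_diff[of "g x"] by (simp add: v_def)
    qed (use Kb in \<open>auto simp: v_def K_top clip_top\<close>)
    have uvw: "dominated \<E> (\<lambda>x. clip a b (g x) + W (g x)) (\<lambda>x. clip a b (g x) - W (g x))"
      by (rule cut[of b]) (use ab clip_le clip_top in auto)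
    have minus: "dominated \<E> (\<lambda>x. clip a (b + d) (g x)) (\<lambda>x. K (g x) - W (g x))"
      using dominated_add[of \<E> u v "\<lambda>x. W (g x)"] dom[of g] uw uvw
      by (simp add: uv clip_eq)
    have vu: "v x + u x = clip a b (g x)" "v x - u x = - K (g x)" for x
      by (simp_all add: u_def v_def field_simps)
    have "dominated \<E> (\<lambda>x. clip a (b + d) (g x)) (\<lambda>x. - K (g x) - W (g x))"
      using dominated_add[of \<E> v u "\<lambda>x. W (g x)"] dom[of g] vw uvw
      by (simp add: vu clip_eq)
    then have plus: "dominated \<E> (\<lambda>x. clip a (b + d) (g x)) (\<lambda>x. K (g x) + W (g x))"
      using dominated_uminus_right[of \<E> _ "\<lambda>x. K (g x) + W (g x)"] by simp
    have "dominated \<E> (\<lambda>x. clip a (b + d) (g x))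
        (\<lambda>x. (1 - (1 + \<sigma>) / 2) * (K (g x) - W (g x)) + (1 + \<sigma>) / 2 * (K (g x) + W (g x)))"
      by (rule dominated_convex[OF conv minus plus]) (use \<sigma> in auto)
    moreover have "(1 - (1 + \<sigma>) / 2) * (k - w) + (1 + \<sigma>) / 2 * (k + w) = k + \<sigma> * w" for k w :: real
      by (simp add: field_simps)
    ultimately show ?thesis by simp
  qed
  show ?thesis
    using ab d nc' dom' unfolding clip_operates_def W_def[symmetric] by (simp add: K_clip' W_clip)
qed

text \<open>Extension only adds slices above; reflecting before and after adds them below.\<close>

lemma clip_operates_reflect:
  assumes "clip_operates \<E> a b K"
  shows "clip_operates \<E> b a (\<lambda>s. K (- s))"
proof -
  have clip: "clip a b (- s) = - clip b a s" for s
    using assms by (auto simp: clip_def clip_operates_def)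
  have "normal_contraction (\<lambda>s. K (- s))"
  proof (rule normal_contractionI)
    fix s t :: real assume "s \<le> t"
    then show "\<bar>K (- s) - K (- t)\<bar> \<le> t - s"
      using normal_contractionD[of K "- s" "- t"] assms by (simp add: clip_operates_def)
  qed (use assms in \<open>simp add: clip_operates_def normal_contraction_def\<close>)
  moreover have "dominated \<E> (\<lambda>x. clip b a (g x)) (\<lambda>x. K (- g x))" for g
  proof -
    have "dominated \<E> (\<lambda>x. clip a b (- g x)) (\<lambda>x. K (- g x))"
      using assms unfolding clip_operates_def by (elim conjE) (rule spec[where x = "\<lambda>x. - g x"])
    then show ?thesis unfolding clip by simp
  qed
  moreover have "K (- clip b a s) = K (- s)" for s
    using assms unfolding clip_operates_def by (metis clip)
  ultimately show ?thesis
    using assms unfolding clip_operates_def by auto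
qed

lemma exists_clip_operates_grid:
  assumes lsc: "lower_semicontinuous \<E>" and conv: "convex_functional \<E>"
    and cut: "\<forall>\<alpha>>0. operates_on (C_cut \<alpha>) \<E>"
    and C: "normal_contraction C" and h: "h > 0"
  shows "\<exists>K. clip_operates \<E> (real n * h) (real n * h) K \<and>
    (\<forall>k::int. \<bar>k\<bar> \<le> int n \<longrightarrow> K (of_int k * h) = C (of_int k * h))"
proof (induction n)
  case 0
  have "clip_operates \<E> 0 0 (\<lambda>_. 0)"
    by (auto simp: clip_operates_def clip_def dominated_def intro!: normal_contractionI)
  then show ?case
    using normal_contraction_zero[OF C] by auto
next
  case (Suc n)
  then obtain K where K: "clip_operates \<E> (real n * h) (real n * h) K"
    and eq: "\<And>k::int. \<bar>k\<bar> \<le> int n \<Longrightarrow> K (of_int k * h) = C (of_int k * h)" by blast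
  define W where "W s = max 0 (min (s - real n * h) h)" for s
  \<comment> \<open>The slopes are difference quotients of \<open>C\<close> over the two new cells,
    hence at most 1 in modulus. For \<open>\<tau>\<close> the difference is taken outwards, because
    \<open>W (- s)\<close> grows to the left.\<close>
  define \<sigma> where "\<sigma> = (C (real (Suc n) * h) - C (real n * h)) / h"
  define \<tau> where "\<tau> = (C (- (real (Suc n) * h)) - C (- (real n * h))) / h"
  have \<sigma>: "\<bar>\<sigma>\<bar> \<le> 1"
    using normal_contractionD[OF C, of "real (Suc n) * h" "real n * h"] h
    by (simp add: \<sigma>_def field_simps)
  have \<tau>: "\<bar>\<tau>\<bar> \<le> 1"
    using normal_contractionD[OF C, of "- (real (Suc n) * h)" "- (real n * h)"] h
    by (simp add: \<tau>_def field_simps)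
  have n: "real n * h + h = real (Suc n) * h" by (simp add: algebra_simps)
  define L where "L s = K s + \<sigma> * W s + \<tau> * W (- s)" for s
  have "clip_operates \<E> (real n * h) (real (Suc n) * h) (\<lambda>s. K s + \<sigma> * W s)"
    using clip_operates_extend[OF lsc conv cut K, of h \<sigma>] h \<sigma> unfolding n W_def by simp
  from clip_operates_extend[OF lsc conv cut clip_operates_reflect[OF this], of h \<tau>]
  have "clip_operates \<E> (real (Suc n) * h) (real (Suc n) * h)
      (\<lambda>s. K (- s) + \<sigma> * W (- s) + \<tau> * W s)"
    using h \<tau> unfolding n W_def by simp
  from clip_operates_reflect[OF this]
  have L: "clip_operates \<E> (real (Suc n) * h) (real (Suc n) * h) L"
    by (simp add: L_def[abs_def])
  \<comment> \<open>Beyond the old interval \<open>K\<close> keeps its end values, so at a new end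
    point the slope term supplies exactly the missing increment of \<open>C\<close>.\<close>
  have Kclip: "K s = K (clip (real n * h) (real n * h) s)" for s
    using K unfolding clip_operates_def by simp
  have Kn: "K (real n * h) = C (real n * h)" "K (- (real n * h)) = C (- (real n * h))"
    using eq[of "int n"] eq[of "- int n"] by simp_all
  have ends: "clip (real n * h) (real n * h) (real n * h + h) = real n * h"
    "clip (real n * h) (real n * h) (- (real n * h + h)) = - (real n * h)"
    "W (real n * h + h) = h" "W (- (real n * h + h)) = 0"
  proof -
    define m where "m = real n * h"
    have "0 \<le> m" using h by (simp add: m_def)
    then show "clip (real n * h) (real n * h) (real n * h + h) = real n * h"
      "clip (real n * h) (real n * h) (- (real n * h + h)) = - (real n * h)"
      "W (real n * h + h) = h" "W (- (real n * h + h)) = 0"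
      using h unfolding W_def m_def[symmetric] by (simp_all add: clip_def)
  qed
  have "L (of_int k * h) = C (of_int k * h)" if "\<bar>k\<bar> \<le> int (Suc n)" for k
  proof -
    consider "\<bar>k\<bar> \<le> int n" | "k = int (Suc n)" | "k = - int (Suc n)"
    proof -
      have "\<bar>k\<bar> \<le> int n \<or> k = int (Suc n) \<or> k = - int (Suc n)"
        using \<open>\<bar>k\<bar> \<le> int (Suc n)\<close> by arith
      then show ?thesis using that by blast
    qed
    then show ?thesis
    proof cases
      case 1
      then have "\<bar>of_int k\<bar> \<le> real n" by linarith
      then have "\<bar>of_int k * h\<bar> \<le> real n * h" using h by (simp add: abs_mult)
      then have "W (of_int k * h) = 0" "W (- (of_int k * h)) = 0" by (auto simp: W_def)
      then show ?thesis using eq[OF 1] by (simp add: L_def)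
    next
      case 2
      have k: "of_int k * h = real n * h + h" unfolding 2 by (simp add: algebra_simps)
      have "K (real n * h + h) = K (real n * h)" by (subst Kclip) (simp only: ends)
      then show ?thesis
        unfolding k using h Kn by (simp only: L_def ends) (simp add: \<sigma>_def n)
    next
      case 3
      have k: "of_int k * h = - (real n * h + h)" unfolding 3 by (simp add: algebra_simps)
      have "K (- (real n * h + h)) = K (- (real n * h))" by (subst Kclip) (simp only: ends)
      then show ?thesis
        unfolding k using h Kn by (simp only: L_def ends minus_minus) (simp add: \<tau>_def n)
    qed
  qed
  with L show ?case by blast
qed

section \<open>Approximation of arbitrary normal contractions\<close>

lemma operates_on_normal_contraction:
  assumes lsc: "lower_semicontinuous \<E>" and conv: "convex_functional \<E>"
    and cut: "\<forall>\<alpha>>0. operates_on (C_cut \<alpha>) \<E>"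
    and C: "normal_contraction C"
  shows "operates_on C \<E>"
  unfolding operates_on_iff_dominated
proof
  fix g
  define h where "h n = 1 / real (Suc n)" for n
  have h: "h n > 0" for n by (simp add: h_def)
  \<comment> \<open>With \<open>(Suc n)^2\<close> cells on each side of 0, the mesh tends to 0 while
    the intervals exhaust the line.\<close>
  have hn: "real ((Suc n)\<^sup>2) * h n = real (Suc n)" for n
  proof -
    have "r * r * (1 / r) = r" for r :: real by simp
    then show ?thesis by (simp only: h_def power2_eq_square of_nat_mult)
  qed
  obtain K where K: "\<And>n. clip_operates \<E> (real (Suc n)) (real (Suc n)) (K n)"
    and eq: "\<And>n k. \<bar>k\<bar> \<le> int ((Suc n)\<^sup>2) \<Longrightarrow> K n (of_int k * h n) = C (of_int k * h n)"
    using exists_clip_operates_grid[OF lsc conv cut C h, of "(Suc n)\<^sup>2" n for n]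
    unfolding hn by metis
  show "dominated \<E> g (\<lambda>x. C (g x))"
  proof (rule dominated_lim[OF lsc])
    show "dominated \<E> g (\<lambda>x. K n (g x))" for n
    proof (rule dominated_trans)
      show "dominated \<E> g (\<lambda>x. clip (real (Suc n)) (real (Suc n)) (g x))"
        using operates_on_clip[OF lsc cut] unfolding operates_on_iff_dominated by simp
      show "dominated \<E> (\<lambda>x. clip (real (Suc n)) (real (Suc n)) (g x)) (\<lambda>x. K n (g x))"
        using K unfolding clip_operates_def by blast
    qed
    fix x
    \<comment> \<open>\<open>K n\<close> and \<open>C\<close> agree at the grid point to the left of
      \<open>s\<close>, and from there each moves by at most one mesh width.\<close>
    have close: "\<bar>K n s - C s\<bar> \<le> 2 * h n" if "\<bar>s\<bar> \<le> real (Suc n)" for n s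
    proof -
      define k where "k = \<lfloor>s / h n\<rfloor>"
      have k: "of_int k * h n \<le> s" "s < of_int k * h n + h n"
      proof -
        have "of_int k \<le> s / h n" "s / h n < of_int k + 1" unfolding k_def by linarith+
        then show "of_int k * h n \<le> s" "s < of_int k * h n + h n"
          using h[of n] by (simp_all add: field_simps)
      qed
      have "\<bar>s / h n\<bar> \<le> real ((Suc n)\<^sup>2)"
        using that h[of n] hn[of n] by (simp add: pos_divide_le_eq)
      then have "\<bar>k\<bar> \<le> int ((Suc n)\<^sup>2)" unfolding k_def by linarith
      from eq[OF this] have "K n (of_int k * h n) = C (of_int k * h n)" .
      moreover have "\<bar>K n s - K n (of_int k * h n)\<bar> \<le> \<bar>s - of_int k * h n\<bar>"
        using K[of n] normal_contractionD unfolding clip_operates_def by blast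
      moreover have "\<bar>C s - C (of_int k * h n)\<bar> \<le> \<bar>s - of_int k * h n\<bar>"
        using normal_contractionD[OF C] by blast
      ultimately show ?thesis using k by linarith
    qed
    have "eventually (\<lambda>n. \<bar>g x\<bar> \<le> real (Suc n)) sequentially"
      by (rule eventually_sequentiallyI[of "nat \<lceil>\<bar>g x\<bar>\<rceil>"]) linarith
    then have "eventually (\<lambda>n. norm (K n (g x) - C (g x)) \<le> 2 * h n) sequentially"
      by eventually_elim (simp add: close)
    moreover have "(\<lambda>n. 2 * h n) \<longlonglongrightarrow> 2 * 0"
      unfolding h_def by (intro tendsto_intros LIMSEQ_Suc lim_1_over_n)
    ultimately have "(\<lambda>n. K n (g x) - C (g x)) \<longlonglongrightarrow> 0"
      using Lim_null_comparison[of "\<lambda>n. K n (g x) - C (g x)" "\<lambda>n. 2 * h n"] by simp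
    then show "(\<lambda>n. K n (g x)) \<longlonglongrightarrow> C (g x)"
      by (simp add: LIM_zero_iff)
  qed
qed

section \<open>Folds, homogeneity and the equivalences\<close>

lemma operates_on_C_cut_of_D_fold:
  assumes "convex_functional \<E>" and "operates_on (D_fold \<alpha>) \<E>" and "0 \<le> \<alpha>"
  shows "operates_on (C_cut \<alpha>) \<E>"
  unfolding operates_on_iff_dominated
proof
  fix g
  have "dominated \<E> g (\<lambda>x. - D_fold \<alpha> (g x))"
    using assms(2) by (simp add: operates_on_iff_dominated)
  from dominated_convex[OF assms(1) dominated_refl this, of "1 / 2"]
  have "dominated \<E> g (\<lambda>x. (1 - 1 / 2) * g x + 1 / 2 * - D_fold \<alpha> (g x))"
    by simp
  moreover have "(1 - 1 / 2) * s + 1 / 2 * - D_fold \<alpha> s = C_cut \<alpha> s" for s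
    using assms(3) by (auto simp: C_cut_def D_fold_def min_def abs_if field_simps)
  ultimately show "dominated \<E> g (\<lambda>x. C_cut \<alpha> (g x))" by simp
qed

text \<open>Rescaling arguments and values by \<open>\<alpha>\<close> turns the cut at 1 into the
  cut at \<open>\<alpha>\<close>, and homogeneity takes the same factor
  \<open>\<alpha> powr p\<close> out of all four terms.\<close>

lemma operates_on_C_cut_scale:
  assumes hom: "positively_homogeneous p \<E>" and "operates_on (C_cut 1) \<E>" and "0 < \<alpha>"
  shows "operates_on (C_cut \<alpha>) \<E>"
  unfolding operates_on_def
proof (intro allI)
  fix f g :: "'a \<Rightarrow> real"
  have scale: "\<E> u = ennreal (\<alpha> powr p) * \<E> (\<lambda>x. u x / \<alpha>)" for u
  proof -
    have "\<E> (\<lambda>x. \<alpha> * (u x / \<alpha>)) = ennreal (\<alpha> powr p) * \<E> (\<lambda>x. u x / \<alpha>)"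
      using hom[unfolded positively_homogeneous_def, rule_format, of \<alpha> "\<lambda>x. u x / \<alpha>"] \<open>0 < \<alpha>\<close>
      by linarith
    then show ?thesis using \<open>0 < \<alpha>\<close> by simp
  qed
  have cut: "C_cut \<alpha> s / \<alpha> = C_cut 1 (s / \<alpha>)" for s
    using \<open>0 < \<alpha>\<close> by (auto simp: C_cut_def min_def field_simps)
  have "\<E> (\<lambda>x. f x / \<alpha> + C_cut 1 (g x / \<alpha>)) + \<E> (\<lambda>x. f x / \<alpha> - C_cut 1 (g x / \<alpha>))
      \<le> \<E> (\<lambda>x. f x / \<alpha> + g x / \<alpha>) + \<E> (\<lambda>x. f x / \<alpha> - g x / \<alpha>)"
    using assms(2)[unfolded operates_on_def, rule_format, of "\<lambda>x. f x / \<alpha>" "\<lambda>x. g x / \<alpha>"] .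
  then have "ennreal (\<alpha> powr p) * (\<E> (\<lambda>x. f x / \<alpha> + C_cut 1 (g x / \<alpha>)) + \<E> (\<lambda>x. f x / \<alpha> - C_cut 1 (g x / \<alpha>)))
      \<le> ennreal (\<alpha> powr p) * (\<E> (\<lambda>x. f x / \<alpha> + g x / \<alpha>) + \<E> (\<lambda>x. f x / \<alpha> - g x / \<alpha>))"
    by (rule mult_left_mono) simp
  then show "\<E> (\<lambda>x. f x + C_cut \<alpha> (g x)) + \<E> (\<lambda>x. f x - C_cut \<alpha> (g x))
      \<le> \<E> (\<lambda>x. f x + g x) + \<E> (\<lambda>x. f x - g x)"
    by (subst (1 2 3 4) scale) (simp add: cut distrib_left add_divide_distrib diff_divide_distrib)
qed

theorem theorem4p9:
  fixes \<E> :: "('x \<Rightarrow> real) \<Rightarrow> ennreal"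
  assumes "convex_functional \<E>"
    and "\<E> (\<lambda>x. 0) = 0"
    and "lower_semicontinuous \<E>"
  shows "((\<forall>C. normal_contraction C \<longrightarrow> operates_on C \<E>) \<longleftrightarrow> (\<forall>\<alpha>>0. operates_on (C_cut \<alpha>) \<E>))
       \<and> ((\<forall>C. normal_contraction C \<longrightarrow> operates_on C \<E>) \<longleftrightarrow> (\<forall>\<beta>. operates_on (D_fold \<beta>) \<E>))
       \<and> ((\<exists>p\<ge>1. positively_homogeneous p \<E>) \<longrightarrow>
            ((\<forall>C. normal_contraction C \<longrightarrow> operates_on C \<E>) \<longleftrightarrow> operates_on (C_cut 1) \<E>)
          \<and> ((\<forall>C. normal_contraction C \<longrightarrow> operates_on C \<E>) \<longleftrightarrow> operates_on (D_fold 1) \<E>))"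
proof -
  let ?i = "\<forall>C. normal_contraction C \<longrightarrow> operates_on C \<E>"
  have ii_i: "?i" if "\<forall>\<alpha>>0. operates_on (C_cut \<alpha>) \<E>"
    using operates_on_normal_contraction[OF assms(3,1) that] by blast
  have iv_i: "?i" if "positively_homogeneous p \<E>" "operates_on (C_cut 1) \<E>" for p
    using ii_i operates_on_C_cut_scale[OF that] by blast
  \<comment> \<open>Stated for a single level, this serves both the whole family of folds and the
    fold at 1.\<close>
  have fold_cut: "operates_on (C_cut \<alpha>) \<E>" if "operates_on (D_fold \<alpha>) \<E>" "\<alpha> > 0" for \<alpha>
    using operates_on_C_cut_of_D_fold[OF assms(1) that(1)] that(2) by simp
  have "?i \<longleftrightarrow> (\<forall>\<alpha>>0. operates_on (C_cut \<alpha>) \<E>)"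
    using ii_i normal_contraction_C_cut by blast
  moreover have "?i \<longleftrightarrow> (\<forall>\<beta>. operates_on (D_fold \<beta>) \<E>)"
    using ii_i fold_cut normal_contraction_D_fold by blast
  moreover have "?i \<longleftrightarrow> operates_on (C_cut 1) \<E>" if "positively_homogeneous p \<E>" for p
    using iv_i[OF that] normal_contraction_C_cut zero_less_one by blast
  moreover have "?i \<longleftrightarrow> operates_on (D_fold 1) \<E>" if "positively_homogeneous p \<E>" for p
    using iv_i[OF that] fold_cut normal_contraction_D_fold zero_less_one by blast
  ultimately show ?thesis by blast
qed

end
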